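(* Let $x \in \{\Omega_{4a}, \Omega_{4b}, \Omega_{4c}, \Omega_{4d}\}$, $y \in \{\Omega_{4e}, \Omega_{4f}, \Omega_{4g}, \Omega_{4h}\}$ and $z \in \{\Omega_{5a}, \Omega_{5b}, \Omega_{5c}, \Omega_{5d}, \Omega_{5e}, \Omega_{5f}\}$ be arbitrary. Then $\{x, y, z\}$ is a generating set of oriented singular Reidemeister moves: up to nonsingular oriented Reidemeister moves, the three moves $x, y, z$ generate all the moves $\Omega_{4a}, \ldots, \Omega_{4h}, \Omega_{5a}, \ldots, \Omega_{5f}$. This gives $4 \cdot 4 \cdot 6 = 96$ generating sets.
   Context: An oriented singular link diagram is a generic immersion of finitely many oriented circles in the plane whose only multiple points are transverse double points, each of which is either a classical crossing (with over/under information) or a singular crossing (a double point with no over/under information). Diagrams, and tangle diagrams in a disc, are considered up to planar isotopy. Each move below replaces one tangle diagram in a disc by another with the same boundary, and may be applied in either direction. Nonsingular moves: all oriented versions of the classical Reidemeister moves, namely $\Omega_1$ (adding or removing a kink with one classical crossing), $\Omega_2$ (adding or removing a bigon between two strands, one of which passes over the other at both classical crossings), and $\Omega_3$ (moving a strand across the crossing of two other strands, where the three pairwise crossings are classical and one strand is over both others, one is under both others, and one is in between). All orientations of the strands are allowed. Singular moves of type $\Omega_4$: in a disc, two strands meet at one singular crossing, one oriented from south-west to north-east and the other from south-east to north-west. A third arc, all of whose crossings with these two strands are classical, is moved from one side of the singular crossing to the other. The arc passes either over both strands at all its crossings (over-type) or under both strands at all its crossings (under-type). For each type there are four oriented versions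 up to planar isotopy: the arc is vertical, moved from the left of the singular crossing to the right, and is oriented upward or downward (two versions); or the arc is horizontal, moved from below the singular crossing to above, and is oriented to the left or to the right (two versions). These eight moves are denoted $\Omega_{4a}, \ldots, \Omega_{4h}$. The four moves $\Omega_{4a}, \Omega_{4b}, \Omega_{4c}, \Omega_{4d}$ are the four moves of one of the two types (over or under), and $\Omega_{4e}, \Omega_{4f}, \Omega_{4g}, \Omega_{4h}$ are the four moves of the other type. Singular moves of type $\Omega_5$: consider two-strand vertical tangles written as braid-like words (composition by vertical stacking), where $\tau$ denotes a singular crossing of the two strands and $\sigma^{\pm 1}$ denotes the two classical crossings of the two strands. The unoriented moves are $\sigma\tau \leftrightarrow \tau\sigma$ and $\sigma^{-1}\tau \leftrightarrow \tau\sigma^{-1}$. In each of them one strand joins the bottom-left to the top-left endpoint and the other joins the bottom-right to the top-right endpoint. Orienting the strands gives, up to planar isotopy (including rotation), three oriented versions of each: both strands oriented in parallel; the left strand upward and the right strand downward; the left strand downward and the right strand upward. The resulting six oriented moves are denoted $\Omega_{5a}, \ldots, \Omega_{5f}$. The oriented singular Reidemeister moves are the fourteen moves $\Omega_{4a}, \ldots, \Omega_{4h}, \Omega_{5a}, \ldots, \Omega_{5f}$. A set $S$ of such moves is a generating set of oriented singular Reidemeister moves (up to nonsingular Reidemeister moves) if, for each of the fourteen moves, its two tangle diagrams in a disc are related by a finite sequence of planar isotopies, nonsingular oriented Reidemeister moves, and moves in $S$ (in either direction), all performed inside the disc. *)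

theory Defs
  imports Main
begin

text \<open>
  The disc is drawn as a rectangle whose marked boundary points lie on the bottom and the top side.
  A tangle diagram in Morse position is read from bottom to top as a list of layers, each of which
  consists of one elementary piece (a local minimum, a local maximum or a double point) between
  vertical strands. Orientations are recorded by the direction of a strand at each horizontal
  level. Planar isotopy relative to the boundary is the equivalence relation generated by the
  height exchange of distant pieces, the cancellation of a minimum against a maximum, and the
  passage of a double point through a maximum or a minimum.
\<close>

datatype dir = Up | Dn

fun opp :: "dir \<Rightarrow> dir" where
  "opp Up = Dn"
| "opp Dn = Up"

text \<open>
  Of the two strands through a double point, one rises from south-west to north-east and the other
  from south-east to north-west (whatever their orientations). \<open>Over\<close> means that the former passes
  over the latter, \<open>Under\<close> that it passes under the latter.
\<close>

datatype crossing = Over | Under | Singular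

text \<open>
  The name of a crossing after the picture is turned by a right angle, or after the mirror image
  exchanging over and under.
\<close>

fun turn :: "crossing \<Rightarrow> crossing" where
  "turn Over = Under"
| "turn Under = Over"
| "turn Singular = Singular"

text \<open>
  \<open>Cup a\<close> has a left leg of direction \<open>a\<close> and a right leg of the opposite direction, and so has
  \<open>Cap a\<close>. In \<open>Cross c a b\<close> the strand from south-west to north-east has direction \<open>a\<close>, the strand
  from south-east to north-west has direction \<open>b\<close>.
\<close>

datatype piece = Cup dir | Cap dir | Cross crossing dir dir

fun lower :: "piece \<Rightarrow> dir list" where
  "lower (Cup a) = []"
| "lower (Cap a) = [a, opp a]"
| "lower (Cross c a b) = [a, b]"

fun upper :: "piece \<Rightarrow> dir list" where
  "upper (Cup a) = [a, opp a]"
| "upper (Cap a) = []"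
| "upper (Cross c a b) = [b, a]"

text \<open>A layer \<open>(l, g, r)\<close> has vertical strands \<open>l\<close> to the left and \<open>r\<close> to the right of \<open>g\<close>.\<close>

type_synonym layer = "dir list \<times> piece \<times> dir list"

text \<open>
  \<open>tangle s D t\<close>: the layers \<open>D\<close> fit together to a tangle diagram with bottom boundary \<open>s\<close> and
  top boundary \<open>t\<close>.
\<close>

fun tangle :: "dir list \<Rightarrow> layer list \<Rightarrow> dir list \<Rightarrow> bool" where
  "tangle s [] t \<longleftrightarrow> s = t"
| "tangle s ((l, g, r) # D) t \<longleftrightarrow> s = l @ lower g @ r \<and> tangle (l @ upper g @ r) D t"

definition widen :: "dir list \<Rightarrow> layer list \<Rightarrow> dir list \<Rightarrow> layer list" where
  "widen l D r = map (\<lambda>(x, g, y). (l @ x, g, y @ r)) D"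

text \<open>A move replaces one diagram of the pair by the other inside a larger diagram.\<close>

type_synonym move = "layer list \<times> layer list"


inductive_set isotopies :: "move set" where
  exchange:
    "([([], g, m @ lower h), (upper g @ m, h, [])],
      [(lower g @ m, h, []), ([], g, m @ upper h)]) \<in> isotopies"
| zigzag_right:
    "([], [([a], Cup (opp a), []), ([], Cap a, [a])]) \<in> isotopies"
| zigzag_left:
    "([], [([], Cup a, [a]), ([a], Cap (opp a), [])]) \<in> isotopies"
| cross_cap:
    "([([a], Cross c b (opp a), []), ([], Cap a, [b])],
      [([], Cross (turn c) a b, [opp a]), ([b], Cap a, [])]) \<in> isotopies"
| cross_cup:
    "([([], Cup a, [b]), ([a], Cross c (opp a) b, [])],
      [([b], Cup a, []), ([], Cross (turn c) b a, [opp a])]) \<in> isotopies"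

text \<open>
  The crossing at which a strand of height \<open>p\<close> rises from south-west to north-east, the other
  strand having height \<open>q\<close>.
\<close>

definition by_height :: "nat \<Rightarrow> nat \<Rightarrow> crossing" where
  "by_height p q = (if p > q then Over else Under)"

inductive_set reidemeister :: "move set" where
  omega1_right: "c \<noteq> Singular \<Longrightarrow>
    ([], [([a], Cup a, []), ([], Cross c a a, [opp a]), ([a], Cap a, [])]) \<in> reidemeister"
| omega1_left: "c \<noteq> Singular \<Longrightarrow>
    ([], [([], Cup (opp a), [a]), ([opp a], Cross c a a, []), ([], Cap (opp a), [a])])
      \<in> reidemeister"
| omega2: "c \<noteq> Singular \<Longrightarrow>
    ([], [([], Cross c a b, []), ([], Cross (turn c) b a, [])]) \<in> reidemeister"
| omega3: "distinct [p, q, r] \<Longrightarrow>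
    ([([], Cross (by_height p q) a b, [c]), ([b], Cross (by_height p r) a c, []),
      ([], Cross (by_height q r) b c, [a])],
     [([a], Cross (by_height q r) b c, []), ([], Cross (by_height p r) a c, [b]),
      ([c], Cross (by_height p q) a b, [])]) \<in> reidemeister"


text \<open>
  In the next two definitions \<open>c\<close> is the crossing of the arc where the arc runs from south-west to
  north-east: \<open>Over\<close> for the over-type, \<open>Under\<close> for the under-type. The direction of the arc is \<open>d\<close>.

  The vertical arc joins the middle bottom point to the middle top point and is moved from the left
  of the singular crossing to the right.
\<close>

definition omega4_vertical :: "crossing \<Rightarrow> dir \<Rightarrow> move" where
  "omega4_vertical c d =
    ([([], Cross (turn c) Up d, [Up]), ([d], Cross Singular Up Up, []), ([], Cross c d Up, [Up])],
     [([Up], Cross c d Up, []), ([], Cross Singular Up Up, [d]), ([Up], Cross (turn c) Up d, [])])"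

text \<open>
  The horizontal arc has its western end bent to the leftmost bottom point and its eastern end bent
  to the rightmost top point, so \<open>d = Up\<close> is the orientation to the right and \<open>d = Dn\<close> the one to
  the left. It is moved from below the singular crossing to above.
\<close>

definition omega4_horizontal :: "crossing \<Rightarrow> dir \<Rightarrow> move" where
  "omega4_horizontal c d =
    ([([], Cross c d Up, [Up]), ([Up], Cross c d Up, []), ([], Cross Singular Up Up, [d])],
     [([d], Cross Singular Up Up, []), ([], Cross c d Up, [Up]), ([Up], Cross c d Up, [])])"

text \<open>Here \<open>a\<close> and \<open>b\<close> are the directions of the left and of the right strand.\<close>

definition omega5 :: "crossing \<Rightarrow> dir \<Rightarrow> dir \<Rightarrow> move" where
  "omega5 c a b =
    ([([], Cross c a b, []), ([], Cross Singular b a, [])],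
     [([], Cross Singular a b, []), ([], Cross c b a, [])])"

datatype singular_move =
    Omega4a | Omega4b | Omega4c | Omega4d
  | Omega4e | Omega4f | Omega4g | Omega4h
  | Omega5a | Omega5b | Omega5c | Omega5d | Omega5e | Omega5f

fun move_of :: "singular_move \<Rightarrow> move" where
  "move_of Omega4a = omega4_vertical Over Up"
| "move_of Omega4b = omega4_vertical Over Dn"
| "move_of Omega4c = omega4_horizontal Over Dn"
| "move_of Omega4d = omega4_horizontal Over Up"
| "move_of Omega4e = omega4_vertical Under Up"
| "move_of Omega4f = omega4_vertical Under Dn"
| "move_of Omega4g = omega4_horizontal Under Dn"
| "move_of Omega4h = omega4_horizontal Under Up"
| "move_of Omega5a = omega5 Over Up Up"
| "move_of Omega5b = omega5 Over Up Dn"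
| "move_of Omega5c = omega5 Over Dn Up"
| "move_of Omega5d = omega5 Under Up Up"
| "move_of Omega5e = omega5 Under Up Dn"
| "move_of Omega5f = omega5 Under Dn Up"


text \<open>
  \<open>local_step M s t D E\<close>: one application, left to right, of a move in \<open>M\<close> in a sub-rectangle,
  all within diagrams with boundary \<open>s\<close>, \<open>t\<close>.
\<close>

inductive local_step :: "move set \<Rightarrow> dir list \<Rightarrow> dir list \<Rightarrow> layer list \<Rightarrow> layer list \<Rightarrow> bool"
  for M s t where
  "(A, B) \<in> M \<Longrightarrow> tangle s (L @ widen l A r @ K) t \<Longrightarrow> tangle s (L @ widen l B r @ K) t
    \<Longrightarrow> local_step M s t (L @ widen l A r @ K) (L @ widen l B r @ K)"

definition equivalent_by :: "move set \<Rightarrow> move \<Rightarrow> bool" where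
  "equivalent_by M m \<longleftrightarrow>
    (\<exists>s t. tangle s (fst m) t \<and> tangle s (snd m) t \<and> equivclp (local_step M s t) (fst m) (snd m))"

definition generating :: "singular_move set \<Rightarrow> bool" where
  "generating S \<longleftrightarrow>
    (\<forall>m. equivalent_by (isotopies \<union> reidemeister \<union> move_of ` S) (move_of m))"


text \<open>No move is void: its two sides are diagrams with the same boundary.\<close>

lemma isotopies_tangle:
  "(A, B) \<in> isotopies \<Longrightarrow> \<exists>s t. tangle s A t \<and> tangle s B t"
proof (induction rule: isotopies.induct)
  case (zigzag_right a)
  then show ?case by (cases a) auto
next
  case (zigzag_left a)
  then show ?case by (cases a) auto
qed auto

lemma reidemeister_tangle:
  "(A, B) \<in> reidemeister \<Longrightarrow> \<exists>s t. tangle s A t \<and> tangle s B t"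
proof (induction rule: reidemeister.induct)
  case (omega1_left c a)
  then show ?case by (cases a) auto
qed auto

lemma move_of_tangle:
  "\<exists>s t. tangle s (fst (move_of m)) t \<and> tangle s (snd (move_of m)) t"
  by (cases m) (auto simp: omega4_vertical_def omega4_horizontal_def omega5_def)

lemma inj_move_of: "inj move_of"
proof (rule injI)
  fix m n
  assume "move_of m = move_of n"
  then show "m = n"
    by (cases m; cases n) (simp_all add: omega4_vertical_def omega4_horizontal_def omega5_def)
qed

end

theory Submission
  imports Defs
begin

text \<open>
  A slide carries an arc over (or under) a singular crossing. Three observations reduce all the
  singular moves to one slide of each type and one move in which a classical crossing of the two
  strands passes their singular crossing.

  First, four points of the boundary of a disc around the singular crossing are joined to it, and
  the arc separates two neighbouring ones from the other two. Push a finger of the arc across one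
  further strand by \<open>\<Omega>\<^sub>2\<close>: part of the arc is now in the position of the neighbouring slide. After
  that slide a bigon is left, and its removal completes the original one. So a slide implies the
  slides of the arc from the two perpendicular sides (\<open>vertical_imp_rising\<close>,
  \<open>rising_imp_vertical\<close>, \<open>falling_imp_vertical\<close>). Bending the ends of the arc turns a rising arc
  into a falling arc of the opposite direction (\<open>reverse_arc\<close>), and turning the whole picture by
  a right angle changes the directions of the two strands (\<open>rotate_crossing\<close>). Hence one slide
  yields all slides of its type, for all directions of the arc and of the strands.

  Second, conjugation by the classical crossing, that is, two applications of \<open>\<Omega>\<^sub>2\<close>, turns
  \<open>\<sigma>\<tau> = \<tau>\<sigma>\<close> into \<open>\<tau>\<sigma>\<^sup>-\<^sup>1 = \<sigma>\<^sup>-\<^sup>1\<tau>\<close> (\<open>crossings_commute_inverse\<close>).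

  Third, and this is the main point, the relation \<open>\<sigma>\<tau> = \<tau>\<sigma>\<close> for one pair of directions implies
  the one for the pair turned by a right angle (\<open>crossings_commute_quarter_turn\<close>). In space the
  relation says that the disc around the singular crossing may be flipped about its vertical axis,
  at the price of opposite half twists of the lower and the upper pair of strands; the turned
  relation is the flip about the horizontal axis. The composition of the two flips is half a
  revolution of the disc in the plane, which winds the four strands around it, and two of them are
  unwound by sliding one over and the other under the singular crossing. Each of these two slides
  passes an end of the sliding strand itself, which costs one kink, so that \<open>\<Omega>\<^sub>1\<close> enters. Four
  quarter turns run through all pairs of directions.

  A bent version of a diagram determines the diagram, since the bend can be straightened
  (\<open>uncap_left\<close>, \<open>uncap_right\<close>). The proofs that turn a picture therefore compare the two sides
  after an end has been closed off by a maximum; then the only isotopies required are height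
  exchanges and the passage of a strand through that maximum.
\<close>

section \<open>Congruence calculus of tangle diagrams\<close>

lemma opp_opp [simp]: "opp (opp a) = a"
  by (cases a) auto

lemma turn_turn [simp]: "turn (turn c) = c"
  by (cases c) auto

lemma turn_eq_Singular [simp]: "turn c = Singular \<longleftrightarrow> c = Singular"
  by (cases c) auto

lemma tangle_append: "tangle s (D @ E) t \<longleftrightarrow> (\<exists>u. tangle s D u \<and> tangle u E t)"
  by (induction s D t rule: tangle.induct) auto

lemma tangle_determines_top: "tangle s D t \<Longrightarrow> tangle s D t' \<Longrightarrow> t = t'"
  by (induction s D t rule: tangle.induct) auto

lemma widen_append: "widen l (D @ E) r = widen l D r @ widen l E r"
  by (simp add: widen_def)

lemma widen_widen: "widen l (widen l' D r') r = widen (l @ l') D (r' @ r)"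
  by (simp add: widen_def split_def)

lemma widen_simps [simp]:
  "widen l [] r = []"
  "widen l ((x, g, y) # D) r = (l @ x, g, y @ r) # widen l D r"
  by (simp_all add: widen_def)

lemma length_widen [simp]: "length (widen l D r) = length D"
  by (simp add: widen_def)

lemma tangle_widen: "tangle s D t \<Longrightarrow> tangle (l @ s @ r) (widen l D r) (l @ t @ r)"
  by (induction s D t rule: tangle.induct) auto

lemma equivclp_map:
  assumes "equivclp R x y" and "\<And>u v. R u v \<Longrightarrow> R' (f u) (f v)"
  shows "equivclp R' (f x) (f y)"
  using assms(1)
proof (induction rule: equivclp_induct)
  case (step y z)
  then show ?case
    by (meson assms(2) equivclp_into_equivclp)
qed simp

locale move_calculus =
  fixes M :: "move set"
  assumes isotopies: "isotopies \<subseteq> M"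
    and reidemeister: "reidemeister \<subseteq> M"
begin

text \<open>
  The top boundary is left implicit because the bottom boundary and the layers determine it. The
  requirement that the diagrams fit together is part of the relation: an empty diagram may be
  expanded to a zigzag only on a strand of the right direction.
\<close>

definition same_tangle :: "dir list \<Rightarrow> layer list \<Rightarrow> layer list \<Rightarrow> bool"
    ("_ \<turnstile> _ \<approx> _" [51, 51, 51] 50) where
  "s \<turnstile> D \<approx> E \<longleftrightarrow>
    (\<exists>t. tangle s D t \<and> tangle s E t \<and> equivclp (local_step M s t) D E)"

lemma same_tangle_refl: "tangle s D t \<Longrightarrow> s \<turnstile> D \<approx> D"
  by (auto simp: same_tangle_def)

lemma same_tangle_sym: "s \<turnstile> D \<approx> E \<Longrightarrow> s \<turnstile> E \<approx> D"
  by (auto simp: same_tangle_def intro: equivclp_sym)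

lemma same_tangle_trans [trans]: "s \<turnstile> D \<approx> E \<Longrightarrow> s \<turnstile> E \<approx> F \<Longrightarrow> s \<turnstile> D \<approx> F"
  unfolding same_tangle_def by (metis equivclp_trans tangle_determines_top)

lemma same_tangle_move:
  assumes "(A, B) \<in> M" "tangle s A t" "tangle s B t"
  shows "s \<turnstile> A \<approx> B"
proof -
  have "local_step M s t ([] @ widen [] A [] @ []) ([] @ widen [] B [] @ [])"
    using assms by (intro local_step.intros) (simp_all add: widen_def)
  then show ?thesis
    using assms by (auto simp: same_tangle_def widen_def)
qed

lemma same_tangle_context:
  assumes AB: "s' \<turnstile> A \<approx> B" and L: "tangle s L (l @ s' @ r)"
    and D: "tangle s (L @ widen l A r @ K) t"
  shows "s \<turnstile> L @ widen l A r @ K \<approx> L @ widen l B r @ K"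
proof -
  obtain t' where A: "tangle s' A t'" and B: "tangle s' B t'"
    and steps: "equivclp (local_step M s' t') A B"
    using AB by (auto simp: same_tangle_def)
  have K: "tangle (l @ t' @ r) K t"
    using L D tangle_widen[OF A, of l r]
    by (auto simp: tangle_append dest: tangle_determines_top)
  have fits: "tangle s (L @ widen l C r @ K) t" if "tangle s' C t'" for C
    using L K tangle_widen[OF that, of l r] by (auto simp: tangle_append)
  have "local_step M s t (L @ widen l C r @ K) (L @ widen l C' r @ K)"
    if "local_step M s' t' C C'" for C C'
    using that
  proof cases
    case (1 A0 B0 L0 l0 r0 K0)
    then show ?thesis
      using fits[of C] fits[of C']
        local_step.intros[of A0 B0 M s "L @ widen l L0 r" "l @ l0" "r0 @ r" "widen l K0 r @ K" t]
      by (simp add: widen_append widen_widen)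
  qed
  then show ?thesis
    using equivclp_map[OF steps, of "local_step M s t" "\<lambda>C. L @ widen l C r @ K"] fits A B
    by (auto simp: same_tangle_def)
qed

text \<open>
  The form of the congruence rule in which a chain of diagrams is justified: \<open>n\<close> layers lie below
  the disc of the move, \<open>l\<close> and \<open>r\<close> are the strands to its left and to its right.
\<close>

lemma replace:
  assumes "s' \<turnstile> A \<approx> B"
    and "D = take n D @ widen l A r @ drop (n + length A) D"
    and "E = take n D @ widen l B r @ drop (n + length A) D"
    and "tangle s (take n D) (l @ s' @ r)"
    and "\<exists>t. tangle s D t"
  shows "s \<turnstile> D \<approx> E"
  using same_tangle_context[OF assms(1,4), of "drop (n + length A) D"] assms(2,3,5) by metis

lemma exchange:
  "lower g @ m @ lower h \<turnstile> [([], g, m @ lower h), (upper g @ m, h, [])]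
     \<approx> [(lower g @ m, h, []), ([], g, m @ upper h)]"
  by (rule same_tangle_move[where t = "upper g @ m @ upper h"])
    (use isotopies isotopies.exchange in auto)

lemma cap_slide:
  "[a, b, opp a] \<turnstile> [([a], Cross c b (opp a), []), ([], Cap a, [b])]
     \<approx> [([], Cross (turn c) a b, [opp a]), ([b], Cap a, [])]"
  by (rule same_tangle_move[where t = "[b]"]) (use isotopies isotopies.cross_cap in auto)

lemma zigzag_right: "[a] \<turnstile> [] \<approx> [([a], Cup (opp a), []), ([], Cap a, [a])]"
  by (rule same_tangle_move[where t = "[a]"]) (use isotopies isotopies.zigzag_right in auto)

lemma zigzag_left: "[a] \<turnstile> [] \<approx> [([], Cup a, [a]), ([a], Cap (opp a), [])]"
  by (rule same_tangle_move[where t = "[a]"]) (use isotopies isotopies.zigzag_left in auto)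

lemma omega1_left:
  assumes "c \<noteq> Singular"
  shows "[a] \<turnstile> []
    \<approx> [([], Cup (opp a), [a]), ([opp a], Cross c a a, []), ([], Cap (opp a), [a])]"
  by (rule same_tangle_move[where t = "[a]"])
    (use reidemeister reidemeister.omega1_left[OF assms] in auto)

lemma omega2:
  assumes "c \<noteq> Singular"
  shows "[a, b] \<turnstile> [] \<approx> [([], Cross c a b, []), ([], Cross (turn c) b a, [])]"
  by (rule same_tangle_move[where t = "[a, b]"])
    (use reidemeister reidemeister.omega2[OF assms] in auto)

section \<open>Bending ends\<close>

text \<open>
  A piece to the left of a whole diagram moves from above it to below it by one height exchange per
  layer; \<open>exchange_right\<close> is the mirror image. They are used for minima, which are thereby brought
  below the diagram that they straighten.
\<close>

lemma exchange_left:
  "tangle s D t \<Longrightarrow>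
    lower g @ s \<turnstile> widen (lower g) D [] @ [([], g, t)] \<approx> ([], g, s) # widen (upper g) D []"
proof (induction D arbitrary: s)
  case Nil
  then show ?case
    by (simp add: same_tangle_refl)
next
  case (Cons x D)
  obtain l h r where x: "x = (l, h, r)"
    by (cases x)
  let ?u = "l @ upper h @ r"
  have s: "s = l @ lower h @ r" and D: "tangle ?u D t"
    using Cons.prems by (auto simp: x)
  have "lower g @ s \<turnstile> widen (lower g) (x # D) [] @ [([], g, t)]
      \<approx> (lower g @ l, h, r) # ([], g, ?u) # widen (upper g) D []"
    using tangle_widen[OF D, of "lower g" "[]"]
    by (intro replace[OF Cons.IH[OF D], where n = 1 and l = "[]" and r = "[]"])
      (simp_all add: x s widen_append widen_widen tangle_append)
  also have "lower g @ s \<turnstile> \<dots> \<approx> ([], g, s) # widen (upper g) (x # D) []"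
    using tangle_widen[OF D, of "upper g" "[]"]
    by (intro replace[OF same_tangle_sym[OF exchange[of g l h]],
          where n = 0 and l = "[]" and r = r]) (auto simp: x s)
  finally show ?case .
qed

lemma exchange_right:
  "tangle s D t \<Longrightarrow>
    s @ lower h \<turnstile> widen [] D (lower h) @ [(t, h, [])] \<approx> (s, h, []) # widen [] D (upper h)"
proof (induction D arbitrary: s)
  case Nil
  then show ?case
    by (simp add: same_tangle_refl)
next
  case (Cons x D)
  obtain l g r where x: "x = (l, g, r)"
    by (cases x)
  let ?u = "l @ upper g @ r"
  have s: "s = l @ lower g @ r" and D: "tangle ?u D t"
    using Cons.prems by (auto simp: x)
  have "s @ lower h \<turnstile> widen [] (x # D) (lower h) @ [(t, h, [])]
      \<approx> (l, g, r @ lower h) # (?u, h, []) # widen [] D (upper h)"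
    using tangle_widen[OF D, of "[]" "lower h"]
    by (intro replace[OF Cons.IH[OF D], where n = 1 and l = "[]" and r = "[]"])
      (simp_all add: x s widen_append widen_widen tangle_append)
  also have "s @ lower h \<turnstile> \<dots> \<approx> (s, h, []) # widen [] (x # D) (upper h)"
    using tangle_widen[OF D, of "[]" "upper h"]
    by (intro replace[OF exchange[of g r h], where n = 0 and l = l and r = "[]"])
      (auto simp: x s)
  finally show ?case .
qed

text \<open>
  Create a zigzag on the leftmost strand above the diagram, and lower its minimum. Then the diagram
  appears with its top left end closed off by a maximum.
\<close>

lemma straighten_left:
  assumes D: "tangle s D (opp d # t)"
  shows "s \<turnstile> D \<approx> ([], Cup (opp d), s) # widen [opp d, d] D [] @ [([opp d], Cap d, t)]"
proof -
  have "s \<turnstile> D \<approx> D @ [([], Cup (opp d), opp d # t), ([opp d], Cap d, t)]"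
    by (rule replace[OF zigzag_left[of "opp d"], where n = "length D" and l = "[]" and r = t])
      (use D in auto)
  also have "s \<turnstile> \<dots> \<approx> ([], Cup (opp d), s) # widen [opp d, d] D [] @ [([opp d], Cap d, t)]"
    by (rule replace[OF exchange_left[OF D, of "Cup (opp d)"],
          where n = 0 and l = "[]" and r = "[]"])
      (use D in \<open>auto simp: widen_def tangle_append\<close>)
  finally show ?thesis .
qed

lemma straighten_right:
  assumes D: "tangle s D (t @ [opp d])"
  shows "s \<turnstile> D \<approx> (s, Cup d, []) # widen [] D [d, opp d] @ [(t, Cap (opp d), [opp d])]"
proof -
  have "s \<turnstile> D \<approx> D @ [(t @ [opp d], Cup d, []), (t, Cap (opp d), [opp d])]"
    by (rule replace[OF zigzag_right[of "opp d"], where n = "length D" and l = t and r = "[]"])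
      (use D in auto)
  also have "s \<turnstile> \<dots> \<approx> (s, Cup d, []) # widen [] D [d, opp d] @ [(t, Cap (opp d), [opp d])]"
    by (rule replace[OF exchange_right[OF D, of "Cup d"],
          where n = 0 and l = "[]" and r = "[]"])
      (use D in \<open>auto simp: widen_def tangle_append\<close>)
  finally show ?thesis .
qed

text \<open>
  Closing off an end by a maximum loses nothing, as a minimum below restores the end.
\<close>

lemma uncap_left:
  assumes A: "tangle s A (opp d # t)" and B: "tangle s B (opp d # t)"
    and capped: "d # s \<turnstile> widen [d] A [] @ [([], Cap d, t)] \<approx> widen [d] B [] @ [([], Cap d, t)]"
  shows "s \<turnstile> A \<approx> B"
proof -
  have "s \<turnstile> A \<approx> ([], Cup (opp d), s) # widen [opp d, d] A [] @ [([opp d], Cap d, t)]"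
    by (rule straighten_left[OF A])
  also have "s \<turnstile> \<dots> \<approx> ([], Cup (opp d), s) # widen [opp d, d] B [] @ [([opp d], Cap d, t)]"
    by (rule replace[OF capped, where n = 1 and l = "[opp d]" and r = "[]"])
      (use tangle_widen[OF A, of "[opp d, d]" "[]"]
        in \<open>auto simp: widen_append widen_widen tangle_append\<close>)
  also have "s \<turnstile> \<dots> \<approx> B"
    by (rule same_tangle_sym[OF straighten_left[OF B]])
  finally show ?thesis .
qed

lemma uncap_right:
  assumes A: "tangle s A (t @ [opp d])" and B: "tangle s B (t @ [opp d])"
    and capped: "s @ [d] \<turnstile> widen [] A [d] @ [(t, Cap (opp d), [])]
      \<approx> widen [] B [d] @ [(t, Cap (opp d), [])]"
  shows "s \<turnstile> A \<approx> B"
proof -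
  have "s \<turnstile> A \<approx> (s, Cup d, []) # widen [] A [d, opp d] @ [(t, Cap (opp d), [opp d])]"
    by (rule straighten_right[OF A])
  also have "s \<turnstile> \<dots> \<approx> (s, Cup d, []) # widen [] B [d, opp d] @ [(t, Cap (opp d), [opp d])]"
    by (rule replace[OF capped, where n = 1 and l = "[]" and r = "[opp d]"])
      (use tangle_widen[OF A, of "[]" "[d, opp d]"]
        in \<open>auto simp: widen_append widen_widen tangle_append\<close>)
  also have "s \<turnstile> \<dots> \<approx> B"
    by (rule same_tangle_sym[OF straighten_right[OF B]])
  finally show ?thesis .
qed

text \<open>
  Straightening the crossed maximum and passing the crossing through the new maximum produces a
  kink of the first Reidemeister move on one leg.
\<close>

lemma kinked_cap:
  assumes "c \<noteq> Singular"
  shows "[b, opp b] \<turnstile> [([], Cross c b (opp b), []), ([], Cap (opp b), [])] \<approx> [([], Cap b, [])]"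
proof -
  have "[b, opp b] \<turnstile> [([], Cross c b (opp b), []), ([], Cap (opp b), [])]
      \<approx> [([], Cup (opp b), [b, opp b]), ([opp b, b], Cross c b (opp b), []),
          ([opp b], Cap b, [b]), ([], Cap (opp b), [])]"
    by (rule replace[OF straighten_left[of "[b, opp b]" "[([], Cross c b (opp b), [])]" b "[b]"],
          where n = 0 and l = "[]" and r = "[]"]) auto
  also have "[b, opp b] \<turnstile> \<dots>
      \<approx> [([], Cup (opp b), [b, opp b]), ([opp b], Cross (turn c) b b, [opp b]),
          ([opp b, b], Cap b, []), ([], Cap (opp b), [])]"
    by (rule replace[OF cap_slide[of b b c], where n = 1 and l = "[opp b]" and r = "[]"]) auto
  also have "[b, opp b] \<turnstile> \<dots>
      \<approx> [([], Cup (opp b), [b, opp b]), ([opp b], Cross (turn c) b b, [opp b]),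
          ([], Cap (opp b), [b, opp b]), ([], Cap b, [])]"
    by (rule replace[OF same_tangle_sym[OF exchange[of "Cap (opp b)" "[]" "Cap b"]],
          where n = 2 and l = "[]" and r = "[]"]) auto
  also have "[b, opp b] \<turnstile> \<dots> \<approx> [([], Cap b, [])]"
    by (rule replace[OF same_tangle_sym[OF omega1_left[of "turn c" b]],
          where n = 0 and l = "[]" and r = "[opp b]"]) (use assms in auto)
  finally show ?thesis .
qed

section \<open>Sliding an arc across a singular crossing\<close>

text \<open>
  The arc has direction \<open>d\<close>, the strands of the singular crossing have arbitrary directions \<open>x\<close>
  (south-west to north-east) and \<open>y\<close> (south-east to north-west); \<open>c\<close> tells, as in the basic
  moves, whether the arc is over or under. The arc joins the middle points in the vertical version,
  the lower left to the upper right point in the rising one, and the lower right to the upper left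
  point in the falling one. The falling version serves as the common target of the two bending
  arguments below.
\<close>

definition vertical_slide :: "crossing \<Rightarrow> dir \<Rightarrow> dir \<Rightarrow> dir \<Rightarrow> bool" where
  "vertical_slide c d x y \<longleftrightarrow> [x, d, y] \<turnstile>
     [([], Cross (turn c) x d, [y]), ([d], Cross Singular x y, []), ([], Cross c d y, [x])]
     \<approx> [([x], Cross c d y, []), ([], Cross Singular x y, [d]), ([y], Cross (turn c) x d, [])]"

definition rising_slide :: "crossing \<Rightarrow> dir \<Rightarrow> dir \<Rightarrow> dir \<Rightarrow> bool" where
  "rising_slide c d x y \<longleftrightarrow> [d, x, y] \<turnstile>
     [([], Cross c d x, [y]), ([x], Cross c d y, []), ([], Cross Singular x y, [d])]
     \<approx> [([d], Cross Singular x y, []), ([], Cross c d y, [x]), ([y], Cross c d x, [])]"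

definition falling_slide :: "crossing \<Rightarrow> dir \<Rightarrow> dir \<Rightarrow> dir \<Rightarrow> bool" where
  "falling_slide c d x y \<longleftrightarrow> [x, y, d] \<turnstile>
     [([x], Cross (turn c) y d, []), ([], Cross (turn c) x d, [y]), ([d], Cross Singular x y, [])]
     \<approx> [([], Cross Singular x y, [d]), ([y], Cross (turn c) x d, []), ([], Cross (turn c) y d, [x])]"

text \<open>
  The finger: a bigon of the arc with the strand \<open>x\<close> above the singular crossing puts the arc into
  the vertical position; after the vertical slide the bigon is found below the singular crossing.
\<close>

lemma vertical_imp_rising:
  assumes "c \<noteq> Singular" "vertical_slide c d x y"
  shows "rising_slide c d x y"
proof -
  let ?s = "[d, x, y]"
  have "?s \<turnstile> [([], Cross c d x, [y]), ([x], Cross c d y, []), ([], Cross Singular x y, [d])]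
      \<approx> [([], Cross c d x, [y]), ([x], Cross c d y, []), ([], Cross Singular x y, [d]),
          ([y], Cross (turn c) x d, []), ([y], Cross c d x, [])]"
    by (rule replace[OF omega2[of "turn c" x d], where n = 3 and l = "[y]" and r = "[]"])
      (use assms(1) in auto)
  also have "?s \<turnstile> \<dots> \<approx> [([], Cross c d x, [y]), ([], Cross (turn c) x d, [y]),
      ([d], Cross Singular x y, []), ([], Cross c d y, [x]), ([y], Cross c d x, [])]"
    by (rule replace[OF same_tangle_sym[OF assms(2)[unfolded vertical_slide_def]],
          where n = 1 and l = "[]" and r = "[]"]) auto
  also have "?s \<turnstile> \<dots> \<approx>
      [([d], Cross Singular x y, []), ([], Cross c d y, [x]), ([y], Cross c d x, [])]"
    by (rule replace[OF same_tangle_sym[OF omega2[OF assms(1), of d x]],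
          where n = 0 and l = "[]" and r = "[y]"]) auto
  finally show ?thesis
    unfolding rising_slide_def .
qed

lemma rising_imp_vertical:
  assumes "c \<noteq> Singular" "rising_slide c d x y"
  shows "vertical_slide c d x y"
proof -
  let ?s = "[x, d, y]"
  have "?s \<turnstile> [([], Cross (turn c) x d, [y]), ([d], Cross Singular x y, []), ([], Cross c d y, [x])]
      \<approx> [([], Cross (turn c) x d, [y]), ([d], Cross Singular x y, []), ([], Cross c d y, [x]),
          ([y], Cross c d x, []), ([y], Cross (turn c) x d, [])]"
    by (rule replace[OF omega2[OF assms(1), of d x], where n = 3 and l = "[y]" and r = "[]"]) auto
  also have "?s \<turnstile> \<dots> \<approx> [([], Cross (turn c) x d, [y]), ([], Cross c d x, [y]),
      ([x], Cross c d y, []), ([], Cross Singular x y, [d]), ([y], Cross (turn c) x d, [])]"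
    by (rule replace[OF same_tangle_sym[OF assms(2)[unfolded rising_slide_def]],
          where n = 1 and l = "[]" and r = "[]"]) auto
  also have "?s \<turnstile> \<dots> \<approx>
      [([x], Cross c d y, []), ([], Cross Singular x y, [d]), ([y], Cross (turn c) x d, [])]"
    by (rule replace[OF same_tangle_sym[OF omega2[of "turn c" x d]],
          where n = 0 and l = "[]" and r = "[y]"]) (use assms(1) in auto)
  finally show ?thesis
    unfolding vertical_slide_def .
qed

lemma falling_imp_vertical:
  assumes "c \<noteq> Singular" "falling_slide c d x y"
  shows "vertical_slide c d x y"
proof -
  let ?s = "[x, d, y]"
  have "?s \<turnstile> [([], Cross (turn c) x d, [y]), ([d], Cross Singular x y, []), ([], Cross c d y, [x])]
      \<approx> [([x], Cross c d y, []), ([x], Cross (turn c) y d, []),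
          ([], Cross (turn c) x d, [y]), ([d], Cross Singular x y, []), ([], Cross c d y, [x])]"
    by (rule replace[OF omega2[OF assms(1), of d y], where n = 0 and l = "[x]" and r = "[]"]) auto
  also have "?s \<turnstile> \<dots> \<approx> [([x], Cross c d y, []), ([], Cross Singular x y, [d]),
      ([y], Cross (turn c) x d, []), ([], Cross (turn c) y d, [x]), ([], Cross c d y, [x])]"
    by (rule replace[OF assms(2)[unfolded falling_slide_def],
          where n = 1 and l = "[]" and r = "[]"]) auto
  also have "?s \<turnstile> \<dots> \<approx>
      [([x], Cross c d y, []), ([], Cross Singular x y, [d]), ([y], Cross (turn c) x d, [])]"
    by (rule replace[OF same_tangle_sym[OF omega2[of "turn c" y d]],
          where n = 3 and l = "[]" and r = "[x]"]) (use assms(1) in auto)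
  finally show ?thesis
    unfolding vertical_slide_def .
qed

text \<open>
  A maximum that closes off the upper end of the falling arc, once it is passed to the right through
  the two strands, closes off the upper end of a rising arc. The two arcs are the two legs of the
  maximum, whence the opposite directions.
\<close>

lemma reverse_arc:
  assumes "rising_slide c d x y"
  shows "falling_slide c (opp d) x y"
  unfolding falling_slide_def
proof (rule uncap_left[where d = d and t = "[y, x]"])
  let ?s = "[d, x, y, opp d]"
  have "?s \<turnstile> [([d, x], Cross (turn c) y (opp d), []), ([d], Cross (turn c) x (opp d), [y]),
        ([d, opp d], Cross Singular x y, []), ([], Cap d, [y, x])]
      \<approx> [([d, x], Cross (turn c) y (opp d), []), ([d], Cross (turn c) x (opp d), [y]),
        ([], Cap d, [x, y]), ([], Cross Singular x y, [])]"
    by (rule replace[OF same_tangle_sym[OF exchange[of "Cap d" "[]" "Cross Singular x y"]],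
          where n = 2 and l = "[]" and r = "[]"]) auto
  also have "?s \<turnstile> \<dots> \<approx> [([d, x], Cross (turn c) y (opp d), []), ([], Cross c d x, [opp d, y]),
        ([x], Cap d, [y]), ([], Cross Singular x y, [])]"
    by (rule replace[OF cap_slide[of d x "turn c"], where n = 1 and l = "[]" and r = "[y]"]) auto
  also have "?s \<turnstile> \<dots> \<approx> [([], Cross c d x, [y, opp d]), ([x, d], Cross (turn c) y (opp d), []),
        ([x], Cap d, [y]), ([], Cross Singular x y, [])]"
    by (rule replace[OF same_tangle_sym[OF
            exchange[of "Cross c d x" "[]" "Cross (turn c) y (opp d)"]],
          where n = 0 and l = "[]" and r = "[]"]) auto
  also have "?s \<turnstile> \<dots> \<approx> [([], Cross c d x, [y, opp d]), ([x], Cross c d y, [opp d]),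
        ([x, y], Cap d, []), ([], Cross Singular x y, [])]"
    by (rule replace[OF cap_slide[of d y "turn c"], where n = 1 and l = "[x]" and r = "[]"]) auto
  also have "?s \<turnstile> \<dots> \<approx> [([], Cross c d x, [y, opp d]), ([x], Cross c d y, [opp d]),
        ([], Cross Singular x y, [d, opp d]), ([y, x], Cap d, [])]"
    by (rule replace[OF same_tangle_sym[OF exchange[of "Cross Singular x y" "[]" "Cap d"]],
          where n = 2 and l = "[]" and r = "[]"]) auto
  also have "?s \<turnstile> \<dots> \<approx> [([d], Cross Singular x y, [opp d]), ([], Cross c d y, [x, opp d]),
        ([y], Cross c d x, [opp d]), ([y, x], Cap d, [])]"
    by (rule replace[OF assms[unfolded rising_slide_def],
          where n = 0 and l = "[]" and r = "[opp d]"]) auto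
  also have "?s \<turnstile> \<dots> \<approx> [([d], Cross Singular x y, [opp d]), ([], Cross c d y, [x, opp d]),
        ([y, d], Cross (turn c) x (opp d), []), ([y], Cap d, [x])]"
    by (rule replace[OF same_tangle_sym[OF cap_slide[of d x "turn c"]],
          where n = 2 and l = "[y]" and r = "[]"]) auto
  also have "?s \<turnstile> \<dots> \<approx> [([d], Cross Singular x y, [opp d]),
        ([d, y], Cross (turn c) x (opp d), []), ([], Cross c d y, [opp d, x]), ([y], Cap d, [x])]"
    by (rule replace[OF exchange[of "Cross c d y" "[]" "Cross (turn c) x (opp d)"],
          where n = 1 and l = "[]" and r = "[]"]) auto
  also have "?s \<turnstile> \<dots> \<approx> [([d], Cross Singular x y, [opp d]),
        ([d, y], Cross (turn c) x (opp d), []), ([d], Cross (turn c) y (opp d), [x]),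
        ([], Cap d, [y, x])]"
    by (rule replace[OF same_tangle_sym[OF cap_slide[of d y "turn c"]],
          where n = 2 and l = "[]" and r = "[x]"]) auto
  finally show "d # [x, y, opp d] \<turnstile>
      widen [d] [([x], Cross (turn c) y (opp d), []), ([], Cross (turn c) x (opp d), [y]),
        ([opp d], Cross Singular x y, [])] [] @ [([], Cap d, [y, x])]
      \<approx> widen [d] [([], Cross Singular x y, [opp d]), ([y], Cross (turn c) x (opp d), []),
        ([], Cross (turn c) y (opp d), [x])] [] @ [([], Cap d, [y, x])]"
    by simp
qed auto

text \<open>
  A maximum that closes off the top right end of the falling picture, once it is passed to the left
  through all the crossings, closes off the top left end of the vertical picture. On the way it turns
  the singular crossing by a right angle and crosses the arc.
\<close>

lemma rotate_crossing:
  assumes "vertical_slide c d x y"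
  shows "falling_slide c d (opp y) x"
  unfolding falling_slide_def
proof (rule uncap_right[where d = y and t = "[d, x]"])
  let ?s = "[opp y, x, d, y]"
  have "?s \<turnstile> [([opp y], Cross (turn c) x d, [y]), ([], Cross (turn c) (opp y) d, [x, y]),
        ([d], Cross Singular (opp y) x, [y]), ([d, x], Cap (opp y), [])]
      \<approx> [([opp y], Cross (turn c) x d, [y]), ([], Cross (turn c) (opp y) d, [x, y]),
        ([d, opp y], Cross Singular x y, []), ([d], Cap (opp y), [x])]"
    by (rule replace[OF same_tangle_sym[OF cap_slide[of "opp y" x Singular]],
          where n = 2 and l = "[d]" and r = "[]"]) auto
  also have "?s \<turnstile> \<dots> \<approx> [([opp y], Cross (turn c) x d, [y]), ([opp y, d], Cross Singular x y, []),
        ([], Cross (turn c) (opp y) d, [y, x]), ([d], Cap (opp y), [x])]"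
    by (rule replace[OF exchange[of "Cross (turn c) (opp y) d" "[]" "Cross Singular x y"],
          where n = 1 and l = "[]" and r = "[]"]) auto
  also have "?s \<turnstile> \<dots> \<approx> [([opp y], Cross (turn c) x d, [y]), ([opp y, d], Cross Singular x y, []),
        ([opp y], Cross c d y, [x]), ([], Cap (opp y), [d, x])]"
    by (rule replace[OF same_tangle_sym[OF cap_slide[of "opp y" d c]],
          where n = 2 and l = "[]" and r = "[x]"]) auto
  also have "?s \<turnstile> \<dots> \<approx> [([opp y, x], Cross c d y, []), ([opp y], Cross Singular x y, [d]),
        ([opp y, y], Cross (turn c) x d, []), ([], Cap (opp y), [d, x])]"
    by (rule replace[OF assms[unfolded vertical_slide_def],
          where n = 0 and l = "[opp y]" and r = "[]"]) auto
  also have "?s \<turnstile> \<dots> \<approx> [([opp y, x], Cross c d y, []), ([opp y], Cross Singular x y, [d]),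
        ([], Cap (opp y), [x, d]), ([], Cross (turn c) x d, [])]"
    by (rule replace[OF same_tangle_sym[OF
            exchange[of "Cap (opp y)" "[]" "Cross (turn c) x d"]],
          where n = 2 and l = "[]" and r = "[]"]) auto
  also have "?s \<turnstile> \<dots> \<approx> [([opp y, x], Cross c d y, []), ([], Cross Singular (opp y) x, [y, d]),
        ([x], Cap (opp y), [d]), ([], Cross (turn c) x d, [])]"
    by (rule replace[OF cap_slide[of "opp y" x Singular],
          where n = 1 and l = "[]" and r = "[d]"]) auto
  also have "?s \<turnstile> \<dots> \<approx> [([], Cross Singular (opp y) x, [d, y]), ([x, opp y], Cross c d y, []),
        ([x], Cap (opp y), [d]), ([], Cross (turn c) x d, [])]"
    by (rule replace[OF same_tangle_sym[OF
            exchange[of "Cross Singular (opp y) x" "[]" "Cross c d y"]],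
          where n = 0 and l = "[]" and r = "[]"]) auto
  also have "?s \<turnstile> \<dots> \<approx> [([], Cross Singular (opp y) x, [d, y]),
        ([x], Cross (turn c) (opp y) d, [y]), ([x, d], Cap (opp y), []),
        ([], Cross (turn c) x d, [])]"
    by (rule replace[OF cap_slide[of "opp y" d c], where n = 1 and l = "[x]" and r = "[]"]) auto
  also have "?s \<turnstile> \<dots> \<approx> [([], Cross Singular (opp y) x, [d, y]),
        ([x], Cross (turn c) (opp y) d, [y]), ([], Cross (turn c) x d, [opp y, y]),
        ([d, x], Cap (opp y), [])]"
    by (rule replace[OF same_tangle_sym[OF
            exchange[of "Cross (turn c) x d" "[]" "Cap (opp y)"]],
          where n = 2 and l = "[]" and r = "[]"]) auto
  finally show "[opp y, x, d] @ [y] \<turnstile>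
      widen [] [([opp y], Cross (turn c) x d, []), ([], Cross (turn c) (opp y) d, [x]),
        ([d], Cross Singular (opp y) x, [])] [y] @ [([d, x], Cap (opp y), [])]
      \<approx> widen [] [([], Cross Singular (opp y) x, [d]), ([x], Cross (turn c) (opp y) d, []),
        ([], Cross (turn c) x d, [opp y])] [y] @ [([d, x], Cap (opp y), [])]"
    by simp
qed auto

lemma vertical_slide_quarter_turn:
  "c \<noteq> Singular \<Longrightarrow> vertical_slide c d x y \<Longrightarrow> vertical_slide c d (opp y) x"
  by (rule falling_imp_vertical[OF _ rotate_crossing])

lemma vertical_slide_reverse_arc:
  "c \<noteq> Singular \<Longrightarrow> vertical_slide c d x y \<Longrightarrow> vertical_slide c (opp d) x y"
  by (rule falling_imp_vertical[OF _ reverse_arc[OF vertical_imp_rising]])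

text \<open>
  A quarter turn preserves the direction of the arc and permutes the four pairs of directions of
  the strands cyclically.
\<close>

lemma vertical_slide_all:
  assumes c: "c \<noteq> Singular" and V: "vertical_slide c d Up Up"
  shows "vertical_slide c d' x y"
proof -
  note turned = vertical_slide_quarter_turn[OF c]
  have V': "vertical_slide c d' Up Up"
    using V vertical_slide_reverse_arc[OF c V] by (cases d; cases d') auto
  show ?thesis
    using V' turned[OF V'] turned[OF turned[OF V']] turned[OF turned[OF turned[OF V']]]
    by (cases x; cases y) auto
qed

section \<open>Moving a crossing of the two strands past a singular one\<close>

definition crossings_commute :: "crossing \<Rightarrow> dir \<Rightarrow> dir \<Rightarrow> bool" where
  "crossings_commute c a b \<longleftrightarrow> [a, b] \<turnstile>
     [([], Cross c a b, []), ([], Cross Singular b a, [])]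
     \<approx> [([], Cross Singular a b, []), ([], Cross c b a, [])]"

lemma crossings_commute_inverse:
  assumes "c \<noteq> Singular" "crossings_commute c a b"
  shows "crossings_commute (turn c) b a"
proof -
  let ?s = "[b, a]"
  have "?s \<turnstile> [([], Cross (turn c) b a, []), ([], Cross Singular a b, [])]
      \<approx> [([], Cross (turn c) b a, []), ([], Cross Singular a b, []),
          ([], Cross c b a, []), ([], Cross (turn c) a b, [])]"
    by (rule replace[OF omega2[OF assms(1), of b a], where n = 2 and l = "[]" and r = "[]"]) auto
  also have "?s \<turnstile> \<dots> \<approx> [([], Cross (turn c) b a, []), ([], Cross c a b, []),
      ([], Cross Singular b a, []), ([], Cross (turn c) a b, [])]"
    by (rule replace[OF same_tangle_sym[OF assms(2)[unfolded crossings_commute_def]],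
          where n = 1 and l = "[]" and r = "[]"]) auto
  also have "?s \<turnstile> \<dots> \<approx> [([], Cross Singular b a, []), ([], Cross (turn c) a b, [])]"
    by (rule replace[OF same_tangle_sym[OF omega2[of "turn c" b a]],
          where n = 0 and l = "[]" and r = "[]"]) (use assms(1) in auto)
  finally show ?thesis
    unfolding crossings_commute_def .
qed

text \<open>
  Both sides are closed off at the left by a maximum. Sliding the maximum through the singular
  crossing turns the latter by a right angle, and then one strand can be carried around it.
\<close>

lemma crossings_commute_quarter_turn:
  assumes c: "c \<noteq> Singular"
    and V: "vertical_slide (turn c) (opp b) b a"
    and H: "rising_slide c b (opp b) a"
    and comm: "crossings_commute c b a"
  shows "crossings_commute (turn c) (opp b) a"
  unfolding crossings_commute_def
proof (rule uncap_left[where d = b and t = "[a]"])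
  let ?s = "[b, opp b, a]"
  have "?s \<turnstile> [([b], Cross (turn c) (opp b) a, []), ([b], Cross Singular a (opp b), []),
        ([], Cap b, [a])]
      \<approx> [([b], Cross (turn c) (opp b) a, []), ([], Cross Singular b a, [opp b]), ([a], Cap b, [])]"
    by (rule replace[OF cap_slide[of b a Singular], where n = 1 and l = "[]" and r = "[]"]) auto
  \<comment> \<open>The strand that is going to pass to the left of the singular crossing is also one of the
    strands of that crossing. The kink supplies the missing crossing of the arc with it.\<close>
  also have "?s \<turnstile> \<dots> \<approx> [([b], Cross (turn c) (opp b) a, []), ([], Cross Singular b a, [opp b]),
        ([a], Cross c b (opp b), []), ([a], Cap (opp b), [])]"
    by (rule replace[OF same_tangle_sym[OF kinked_cap[OF c, of b]],
          where n = 2 and l = "[a]" and r = "[]"]) auto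
  also have "?s \<turnstile> \<dots> \<approx> [([], Cross c b (opp b), [a]), ([opp b], Cross Singular b a, []),
        ([], Cross (turn c) (opp b) a, [b]), ([a], Cap (opp b), [])]"
    by (rule replace[OF same_tangle_sym[OF V[unfolded vertical_slide_def]],
          where n = 0 and l = "[]" and r = "[]"]) auto
  \<comment> \<open>Passing the maximum back makes the last crossing one between the two upper ends of the
    singular crossing, to which the hypothesis applies.\<close>
  also have "?s \<turnstile> \<dots> \<approx> [([], Cross c b (opp b), [a]), ([opp b], Cross Singular b a, []),
        ([opp b], Cross c a b, []), ([], Cap (opp b), [a])]"
    by (rule replace[OF same_tangle_sym[OF cap_slide[of "opp b" a c]],
          where n = 2 and l = "[]" and r = "[]"]) auto
  also have "?s \<turnstile> \<dots> \<approx> [([], Cross c b (opp b), [a]), ([opp b], Cross c b a, []),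
        ([opp b], Cross Singular a b, []), ([], Cap (opp b), [a])]"
    by (rule replace[OF same_tangle_sym[OF comm[unfolded crossings_commute_def]],
          where n = 1 and l = "[opp b]" and r = "[]"]) auto
  \<comment> \<open>Once the maximum is passed to the right, its right leg is an arc of the opposite type below the
    turned singular crossing. Sliding this arc up leaves a kinked maximum.\<close>
  also have "?s \<turnstile> \<dots> \<approx> [([], Cross c b (opp b), [a]), ([opp b], Cross c b a, []),
        ([], Cross Singular (opp b) a, [b]), ([a], Cap (opp b), [])]"
    by (rule replace[OF cap_slide[of "opp b" a Singular],
          where n = 2 and l = "[]" and r = "[]"]) auto
  also have "?s \<turnstile> \<dots> \<approx> [([b], Cross Singular (opp b) a, []), ([], Cross c b a, [opp b]),
        ([a], Cross c b (opp b), []), ([a], Cap (opp b), [])]"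
    by (rule replace[OF H[unfolded rising_slide_def],
          where n = 0 and l = "[]" and r = "[]"]) auto
  also have "?s \<turnstile> \<dots> \<approx> [([b], Cross Singular (opp b) a, []), ([], Cross c b a, [opp b]),
        ([a], Cap b, [])]"
    by (rule replace[OF kinked_cap[OF c, of b], where n = 2 and l = "[a]" and r = "[]"]) auto
  also have "?s \<turnstile> \<dots> \<approx> [([b], Cross Singular (opp b) a, []), ([b], Cross (turn c) a (opp b), []),
        ([], Cap b, [a])]"
    by (rule replace[OF same_tangle_sym[OF cap_slide[of b a "turn c"]],
          where n = 1 and l = "[]" and r = "[]"]) auto
  finally show "b # [opp b, a] \<turnstile>
      widen [b] [([], Cross (turn c) (opp b) a, []), ([], Cross Singular a (opp b), [])] []
        @ [([], Cap b, [a])]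
      \<approx> widen [b] [([], Cross Singular (opp b) a, []), ([], Cross (turn c) a (opp b), [])] []
        @ [([], Cap b, [a])]"
    by simp
qed auto

text \<open>
  A quarter turn reverses the type of the classical crossing, and so does the passage to the
  inverse. Their composition keeps the type and runs through all pairs of directions; the inverse
  then supplies the other type.
\<close>

lemma crossings_commute_all:
  assumes slides: "\<And>c d x y. c \<noteq> Singular \<Longrightarrow> vertical_slide c d x y"
    and c: "c \<noteq> Singular" and comm: "crossings_commute c a b" and c': "c' \<noteq> Singular"
  shows "crossings_commute c' a' b'"
proof -
  have turned: "crossings_commute c (opp y) x" if "crossings_commute c x y" for x y
    using crossings_commute_quarter_turn[of "turn c" y x] crossings_commute_inverse[OF c that]
      slides vertical_imp_rising c by simp
  have same: "crossings_commute c x y" for x y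
    using comm turned[OF comm] turned[OF turned[OF comm]] turned[OF turned[OF turned[OF comm]]]
    by (cases a; cases b; cases x; cases y) auto
  have "c' = c \<or> c' = turn c"
    using c c' by (cases c; cases c') auto
  then show ?thesis
    using same[of a' b'] crossings_commute_inverse[OF c same[of b' a']] by auto
qed

lemma equivalent_by_of_same_tangle: "s \<turnstile> fst m \<approx> snd m \<Longrightarrow> equivalent_by M m"
  by (auto simp: same_tangle_def equivalent_by_def)

lemma omega4_vertical_of_vertical_slide:
  "vertical_slide c d Up Up \<Longrightarrow> equivalent_by M (omega4_vertical c d)"
  by (rule equivalent_by_of_same_tangle[of "[Up, d, Up]"])
    (simp add: omega4_vertical_def vertical_slide_def)

lemma omega4_horizontal_of_rising_slide:
  "rising_slide c d Up Up \<Longrightarrow> equivalent_by M (omega4_horizontal c d)"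
  by (rule equivalent_by_of_same_tangle[of "[d, Up, Up]"])
    (simp add: omega4_horizontal_def rising_slide_def)

lemma omega5_of_crossings_commute: "crossings_commute c a b \<Longrightarrow> equivalent_by M (omega5 c a b)"
  by (rule equivalent_by_of_same_tangle[of "[a, b]"])
    (simp add: omega5_def crossings_commute_def)

lemma vertical_slide_of_omega4_vertical:
  "omega4_vertical c d \<in> M \<Longrightarrow> vertical_slide c d Up Up"
  unfolding vertical_slide_def
  by (rule same_tangle_move[where t = "[Up, d, Up]"]) (auto simp: omega4_vertical_def)

lemma rising_slide_of_omega4_horizontal:
  "omega4_horizontal c d \<in> M \<Longrightarrow> rising_slide c d Up Up"
  unfolding rising_slide_def
  by (rule same_tangle_move[where t = "[Up, Up, d]"]) (auto simp: omega4_horizontal_def)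

lemma crossings_commute_of_omega5: "omega5 c a b \<in> M \<Longrightarrow> crossings_commute c a b"
  unfolding crossings_commute_def
  by (rule same_tangle_move[where t = "[a, b]"]) (auto simp: omega5_def)

end

section \<open>The generating sets\<close>

lemma move_calculus_union: "move_calculus (isotopies \<union> reidemeister \<union> N)"
  by unfold_locales auto

lemma generating_triple:
  assumes x: "x \<in> {Omega4a, Omega4b, Omega4c, Omega4d}"
    and y: "y \<in> {Omega4e, Omega4f, Omega4g, Omega4h}"
    and z: "z \<in> {Omega5a, Omega5b, Omega5c, Omega5d, Omega5e, Omega5f}"
  shows "generating {x, y, z}"
proof -
  let ?M = "isotopies \<union> reidemeister \<union> move_of ` {x, y, z}"
  interpret move_calculus ?M
    by (rule move_calculus_union)
  have one_slide: "vertical_slide c d' v w"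
    if c: "c \<noteq> Singular" and "omega4_vertical c d \<in> ?M \<or> omega4_horizontal c d \<in> ?M"
    for c d d' v w
    using that(2) vertical_slide_all[OF c]
      vertical_slide_of_omega4_vertical[of c d]
      rising_imp_vertical[OF c rising_slide_of_omega4_horizontal[of c d]] by blast
  have "\<exists>d. move_of x = omega4_vertical Over d \<or> move_of x = omega4_horizontal Over d"
    using x by auto
  then have "\<exists>d. omega4_vertical Over d \<in> ?M \<or> omega4_horizontal Over d \<in> ?M"
    by (metis UnI2 image_eqI insertCI)
  then have over: "vertical_slide Over d v w" for d v w
    using one_slide[of Over] by auto
  have "\<exists>d. move_of y = omega4_vertical Under d \<or> move_of y = omega4_horizontal Under d"
    using y by auto
  then have "\<exists>d. omega4_vertical Under d \<in> ?M \<or> omega4_horizontal Under d \<in> ?M"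
    by (metis UnI2 image_eqI insertCI)
  then have under: "vertical_slide Under d v w" for d v w
    using one_slide[of Under] by auto
  have slides: "vertical_slide c d v w" if "c \<noteq> Singular" for c d v w
    using that over under by (cases c) auto
  have "\<exists>c a b. c \<noteq> Singular \<and> move_of z = omega5 c a b"
    using z by (elim insertE emptyE) (metis move_of.simps(9-14) crossing.distinct(3,5))+
  then obtain c a b where c: "c \<noteq> Singular" and "move_of z = omega5 c a b"
    by blast
  then have "crossings_commute c a b"
    by (intro crossings_commute_of_omega5) auto
  with c have commute: "crossings_commute c' a' b'" if "c' \<noteq> Singular" for c' a' b'
    using crossings_commute_all[of c a b c'] slides that by blast
  have v: "equivalent_by ?M (omega4_vertical c d)" if "c \<noteq> Singular" for c d
    by (rule omega4_vertical_of_vertical_slide[OF slides[OF that]])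
  have h: "equivalent_by ?M (omega4_horizontal c d)" if "c \<noteq> Singular" for c d
    by (rule omega4_horizontal_of_rising_slide[OF vertical_imp_rising[OF that slides[OF that]]])
  have f: "equivalent_by ?M (omega5 c a b)" if "c \<noteq> Singular" for c a b
    by (rule omega5_of_crossings_commute[OF commute[OF that]])
  have "equivalent_by ?M (move_of m)" for m
    using v h f by (cases m) simp_all
  then show ?thesis
    by (simp add: generating_def)
qed

text \<open>
  As the sets are disjoint, the elements \<open>x\<close>, \<open>y\<close> and \<open>z\<close> are recovered from \<open>{x, y, z}\<close> by
  intersecting it with \<open>A\<close>, \<open>B\<close> and \<open>C\<close>.
\<close>

lemma card_transversals:
  assumes "A \<inter> B = {}" "A \<inter> C = {}" "B \<inter> C = {}"
  shows "card {{x, y, z} | x y z. x \<in> A \<and> y \<in> B \<and> z \<in> C} = card A * card B * card C"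
proof -
  have "inj_on (\<lambda>(x, y, z). {x, y, z}) (A \<times> B \<times> C)"
  proof (rule inj_onI)
    fix p p'
    assume in_p: "p \<in> A \<times> B \<times> C" "p' \<in> A \<times> B \<times> C"
      and eq_p: "(case p of (x, y, z) \<Rightarrow> {x, y, z}) = (case p' of (x, y, z) \<Rightarrow> {x, y, z})"
    obtain x y z x' y' z' where p: "p = (x, y, z)" "p' = (x', y', z')"
      by (metis prod.exhaust)
    have mem: "x \<in> A" "y \<in> B" "z \<in> C" "x' \<in> A" "y' \<in> B" "z' \<in> C"
      and eq: "{x, y, z} = {x', y', z'}"
      using in_p eq_p by (auto simp: p)
    have "{x, y, z} \<inter> A = {x}" "{x', y', z'} \<inter> A = {x'}"
      "{x, y, z} \<inter> B = {y}" "{x', y', z'} \<inter> B = {y'}"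
      "{x, y, z} \<inter> C = {z}" "{x', y', z'} \<inter> C = {z'}"
      using mem assms by auto
    with eq show "p = p'"
      unfolding p by (metis singleton_inject)
  qed
  moreover have "{{x, y, z} | x y z. x \<in> A \<and> y \<in> B \<and> z \<in> C}
      = (\<lambda>(x, y, z). {x, y, z}) ` (A \<times> B \<times> C)"
    by (auto simp: image_def)
  ultimately show ?thesis
    by (simp add: card_image card_cartesian_product)
qed

theorem theorem1:
  shows "(\<forall>x \<in> {Omega4a, Omega4b, Omega4c, Omega4d}.
          \<forall>y \<in> {Omega4e, Omega4f, Omega4g, Omega4h}.
          \<forall>z \<in> {Omega5a, Omega5b, Omega5c, Omega5d, Omega5e, Omega5f}.
            generating {x, y, z})
       \<and> card {{x, y, z} | x y z.
            x \<in> {Omega4a, Omega4b, Omega4c, Omega4d} \<and>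
            y \<in> {Omega4e, Omega4f, Omega4g, Omega4h} \<and>
            z \<in> {Omega5a, Omega5b, Omega5c, Omega5d, Omega5e, Omega5f}} = 96"
proof (intro conjI ballI)
  show "card {{x, y, z} | x y z.
            x \<in> {Omega4a, Omega4b, Omega4c, Omega4d} \<and>
            y \<in> {Omega4e, Omega4f, Omega4g, Omega4h} \<and>
            z \<in> {Omega5a, Omega5b, Omega5c, Omega5d, Omega5e, Omega5f}} = 96"
    by (subst card_transversals) auto
qed (rule generating_triple)

end
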